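(* For any $n \ge 1$ and positive integers $a_1, \ldots, a_n$, we have $\bigstar a_1 + \cdots + \bigstar a_n \in \mathcal{P}$ if and only if $a_1 \oplus \cdots \oplus a_n = 0$.
   Context: Positions are defined recursively: $*L$ and $*R$ are terminal positions; if $G_1,\dots,G_k$ ($k\ge 1$) are positions, then $\{G_1,\dots,G_k\}$ is a position with options $G_1,\dots,G_k$. All positions have finite game trees. Play: Left and Right move alternately, each choosing any option of the current position; when a terminal position is reached, Left wins if it is $*L$ and Right wins if it is $*R$. Disjunctive sum: $*L + *L = *R + *R = *L$, $*L + *R = *R + *L = *R$; if at least one of $G,H$ is non-terminal, $G+H$ has options all $G'+H$ ($G'$ an option of $G$) and all $G+H'$ ($H'$ an option of $H$). Outcome class $\mathcal{P}$: the player who moves second has a winning strategy. Define $\bigstar 1 = \{*L, *R\}$ and, for $m > 1$, $\bigstar m = \{\bigstar(m-1), \ldots, \bigstar 1, *L, *R\}$. The symbol $\oplus$ denotes bitwise XOR (nim-sum) of nonnegative integers. *)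

theory Defs
  imports "HOL-Library.FSet"
begin

datatype pos = StarL | StarR | Opts "pos fset"

primrec options :: "pos \<Rightarrow> pos fset" where
  "options StarL = {||}"
| "options StarR = {||}"
| "options (Opts A) = A"

text \<open>The type also contains nodes without options, such as \<^term>\<open>Opts {||}\<close>; the following
  predicate singles out the genuine positions.\<close>

inductive is_position :: "pos \<Rightarrow> bool" where
  "is_position StarL"
| "is_position StarR"
| "A \<noteq> {||} \<Longrightarrow> (\<And>G. G |\<in>| A \<Longrightarrow> is_position G) \<Longrightarrow> is_position (Opts A)"

definition terminal :: "pos \<Rightarrow> bool" where
  "terminal G \<longleftrightarrow> G = StarL \<or> G = StarR"

lemma terminal_simps [simp]: "terminal StarL" "terminal StarR" "\<not> terminal (Opts A)"
  by (simp_all add: terminal_def)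

lemma size_option_less: "G' |\<in>| options G \<Longrightarrow> size G' < size G"
proof (cases G)
  case (Opts A)
  assume "G' |\<in>| options G"
  with Opts have "G' \<in> fset A" by simp
  then have "size G' \<le> (\<Sum>x\<in>fset A. size x)"
    by (intro member_le_sum) auto
  also have "\<dots> \<le> (\<Sum>x\<in>fset A. Suc (size x))"
    by (intro sum_mono) auto
  also have "\<dots> < size G"
    using Opts by (simp add: size_fset_overloaded_def size_fset_def)
  finally show ?thesis .
qed auto


subsection \<open>Disjunctive sum\<close>

function disj_sum :: "pos \<Rightarrow> pos \<Rightarrow> pos" where
  "disj_sum G H =
    (if terminal G \<and> terminal H then (if G = H then StarL else StarR)
     else Opts ((\<lambda>G'. disj_sum G' H) |`| options G |\<union>| (\<lambda>H'. disj_sum G H') |`| options H))"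
  by auto
termination
  by (relation "measure (\<lambda>(G, H). size G + size H)") (auto dest: size_option_less)

declare disj_sum.simps [simp del]

lemma disj_sum_terminal [simp]:
  "disj_sum StarL StarL = StarL" "disj_sum StarR StarR = StarL"
  "disj_sum StarL StarR = StarR" "disj_sum StarR StarL = StarR"
  by (simp_all add: disj_sum.simps)

lemma disj_sum_nonterminal:
  "\<not> (terminal G \<and> terminal H) \<Longrightarrow>
   disj_sum G H =
     Opts ((\<lambda>G'. disj_sum G' H) |`| options G |\<union>| (\<lambda>H'. disj_sum G H') |`| options H)"
  by (subst disj_sum.simps) auto

lemma terminal_disj_sum [simp]: "terminal (disj_sum G H) \<longleftrightarrow> terminal G \<and> terminal H"
  by (subst disj_sum.simps) auto

lemma options_terminal: "terminal G \<Longrightarrow> options G = {||}"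
  by (auto simp: terminal_def)

lemma options_disj_sum:
  "options (disj_sum G H) =
     (\<lambda>G'. disj_sum G' H) |`| options G |\<union>| (\<lambda>H'. disj_sum G H') |`| options H"
  by (subst disj_sum.simps) (auto simp: options_terminal)

lemma pos_eqI: "\<not> terminal G \<Longrightarrow> \<not> terminal H \<Longrightarrow> options G = options H \<Longrightarrow> G = H"
  by (cases G; cases H) auto

lemma disj_sum_commute: "disj_sum G H = disj_sum H G"
proof (induction "size G + size H" arbitrary: G H rule: less_induct)
  case less
  show ?case
  proof (cases "terminal G \<and> terminal H")
    case True
    then show ?thesis by (auto simp: terminal_def)
  next
    case False
    have "(\<lambda>G'. disj_sum G' H) |`| options G = disj_sum H |`| options G"
      by (intro fset.map_cong refl less) (auto dest: size_option_less)
    moreover have "disj_sum G |`| options H = (\<lambda>H'. disj_sum H' G) |`| options H"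
      by (intro fset.map_cong refl less) (auto dest: size_option_less)
    ultimately have "options (disj_sum G H) = options (disj_sum H G)"
      by (simp add: options_disj_sum sup_commute)
    with False show ?thesis by (intro pos_eqI) auto
  qed
qed

lemma disj_sum_assoc: "disj_sum (disj_sum G H) K = disj_sum G (disj_sum H K)"
proof (induction "size G + size H + size K" arbitrary: G H K rule: less_induct)
  case less
  show ?case
  proof (cases "terminal G \<and> terminal H \<and> terminal K")
    case True
    then show ?thesis by (auto simp: terminal_def)
  next
    case False
    have "(\<lambda>G'. disj_sum (disj_sum G' H) K) |`| options G
        = (\<lambda>G'. disj_sum G' (disj_sum H K)) |`| options G"
      by (intro fset.map_cong refl less) (auto dest: size_option_less)
    moreover have "(\<lambda>H'. disj_sum (disj_sum G H') K) |`| options H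
        = (\<lambda>H'. disj_sum G (disj_sum H' K)) |`| options H"
      by (intro fset.map_cong refl less) (auto dest: size_option_less)
    moreover have "disj_sum (disj_sum G H) |`| options K
        = (\<lambda>K'. disj_sum G (disj_sum H K')) |`| options K"
      by (intro fset.map_cong refl less) (auto dest: size_option_less)
    ultimately have "options (disj_sum (disj_sum G H) K) = options (disj_sum G (disj_sum H K))"
      by (simp add: options_disj_sum fimage_funion fset.map_comp comp_def sup_assoc)
    with False show ?thesis by (intro pos_eqI) auto
  qed
qed

lemma disj_sum_StarL: "disj_sum StarL G = G"
proof (induction "size G" arbitrary: G rule: less_induct)
  case less
  show ?case
  proof (cases "terminal G")
    case True
    then show ?thesis by (auto simp: terminal_def)
  next
    case False
    have "disj_sum StarL |`| options G = (\<lambda>G'. G') |`| options G"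
      by (intro fset.map_cong refl less) (auto dest: size_option_less)
    with False show ?thesis by (intro pos_eqI) (auto simp: options_disj_sum)
  qed
qed

text \<open>\<^const>\<open>StarL\<close> is neutral for the disjunctive sum, so iterated sums are available
  as \<^const>\<open>sum_list\<close>.\<close>

instantiation pos :: comm_monoid_add
begin

definition zero_pos :: pos where "0 = StarL"

definition plus_pos :: "pos \<Rightarrow> pos \<Rightarrow> pos" where "G + H = disj_sum G H"

instance
  by standard (simp_all add: zero_pos_def plus_pos_def disj_sum_assoc disj_sum_StarL,
    rule disj_sum_commute)

end

lemma is_position_disj_sum:
  "is_position G \<Longrightarrow> is_position H \<Longrightarrow> is_position (disj_sum G H)"
proof (induction "size G + size H" arbitrary: G H rule: less_induct)
  case less
  have options: "X' |\<in>| options X \<Longrightarrow> is_position X'" if "is_position X" for X X'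
    using that by cases auto
  have nonempty: "options X \<noteq> {||}" if "is_position X" "\<not> terminal X" for X
    using that by cases auto
  show ?case
  proof (cases "terminal G \<and> terminal H")
    case True
    then show ?thesis by (auto simp: terminal_def intro: is_position.intros)
  next
    case False
    then show ?thesis
      using less.prems nonempty
      by (subst disj_sum_nonterminal)
        (auto intro!: is_position.intros less.hyps dest: size_option_less options)
  qed
qed

lemma is_position_plus: "is_position G \<Longrightarrow> is_position H \<Longrightarrow> is_position (G + H)"
  by (simp add: plus_pos_def is_position_disj_sum)


subsection \<open>Outcomes\<close>

datatype player = Left | Right

primrec opponent :: "player \<Rightarrow> player" where
  "opponent Left = Right"
| "opponent Right = Left"

primrec won_terminal :: "player \<Rightarrow> pos" where
  "won_terminal Left = StarL"
| "won_terminal Right = StarR"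

definition strategy :: "(pos \<Rightarrow> pos) \<Rightarrow> bool" where
  "strategy \<sigma> \<longleftrightarrow> (\<forall>G. options G \<noteq> {||} \<longrightarrow> \<sigma> G |\<in>| options G)"

text \<open>\<open>reachable p \<sigma> G q H r\<close>: if play starts at \<open>G\<close> with \<open>q\<close> to move and player \<open>p\<close> follows \<open>\<sigma>\<close>,
  then position \<open>H\<close> with \<open>r\<close> to move can occur.\<close>

inductive reachable :: "player \<Rightarrow> (pos \<Rightarrow> pos) \<Rightarrow> pos \<Rightarrow> player \<Rightarrow> pos \<Rightarrow> player \<Rightarrow> bool"
  for p \<sigma> G q where
  start: "reachable p \<sigma> G q G q"
| own_move: "reachable p \<sigma> G q H p \<Longrightarrow> options H \<noteq> {||} \<Longrightarrow> reachable p \<sigma> G q (\<sigma> H) (opponent p)"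
| opponent_move: "reachable p \<sigma> G q H (opponent p) \<Longrightarrow> H' |\<in>| options H \<Longrightarrow> reachable p \<sigma> G q H' p"

text \<open>Play always ends, since positions have finite game trees; hence a strategy wins iff every
  terminal position it can lead to is a win.\<close>

definition winning_strategy :: "player \<Rightarrow> (pos \<Rightarrow> pos) \<Rightarrow> pos \<Rightarrow> player \<Rightarrow> bool" where
  "winning_strategy p \<sigma> G q \<longleftrightarrow>
     strategy \<sigma> \<and> (\<forall>H r. reachable p \<sigma> G q H r \<longrightarrow> terminal H \<longrightarrow> H = won_terminal p)"

text \<open>The second player wins whichever of Left and Right moves first.\<close>

definition outcome_P :: "pos set" where
  "outcome_P = {G. is_position G \<and> (\<forall>q. \<exists>\<sigma>. winning_strategy (opponent q) \<sigma> G q)}"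


subsection \<open>Stars\<close>

text \<open>Only \<open>m \<ge> 1\<close> is meaningful; the recursion makes \<open>bigstar 0\<close> coincide with \<open>bigstar 1\<close>.\<close>

fun bigstar :: "nat \<Rightarrow> pos" where
  "bigstar m = Opts (finsert StarL (finsert StarR (fset_of_list (map bigstar [1..<m]))))"

declare bigstar.simps [simp del]

lemma bigstar_1: "bigstar 1 = Opts {|StarL, StarR|}"
  by (simp add: bigstar.simps)

lemma is_position_bigstar: "is_position (bigstar m)"
proof (induction m rule: less_induct)
  case (less m)
  then show ?case
    by (subst bigstar.simps) (auto simp: fset_of_list_elem intro!: is_position.intros)
qed

lemma is_position_sum_list_bigstar: "is_position (sum_list (map bigstar a))"
  by (induction a)
    (auto simp: zero_pos_def intro: is_position.intros is_position_plus is_position_bigstar)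

end

theory Submission imports Defs begin

text \<open>A sum of stars always stays of the form \<open>\<bigstar>a\<^sub>1 + \<dots> + \<bigstar>a\<^sub>n + T\<close> with \<open>T\<close> terminal, and apart
  from \<open>T\<close> the moves are those of Nim. So the player facing a nonzero nim-sum can restore nim-sum
  zero as in Bouton's theorem. The value of \<open>T\<close> matters only at the last move, which is made from a
  single star; there the mover may choose either terminal and hence picks the winning one.\<close>

section \<open>Winning strategies from invariants, and their exclusiveness\<close>

text \<open>Invariant principle: \<open>I\<close> holds when \<open>p\<close> is to move,
  \<open>J\<close> when the opponent is. A strategy that moves into \<open>J\<close> whenever
  possible keeps the invariant along every play, and \<open>winning_strategy\<close> only constrains
  the terminal positions reached.\<close>

lemma winning_strategyI:
  assumes own: "\<And>H. H \<in> I \<Longrightarrow> \<not> terminal H \<Longrightarrow> \<exists>H'. H' |\<in>| options H \<and> H' \<in> J"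
    and opp: "\<And>H H'. H \<in> J \<Longrightarrow> H' |\<in>| options H \<Longrightarrow> H' \<in> I"
    and final: "\<And>H. H \<in> I \<union> J \<Longrightarrow> terminal H \<Longrightarrow> H = won_terminal p"
    and start: "q = p \<and> G \<in> I \<or> q = opponent p \<and> G \<in> J"
  shows "\<exists>\<sigma>. winning_strategy p \<sigma> G q"
proof -
  \<comment> \<open>The fallback to an arbitrary option makes \<open>\<sigma>\<close> legal also at
    positions from which \<open>J\<close> cannot be reached, as \<open>strategy\<close>
    demands.\<close>
  define \<sigma> where "\<sigma> H = (if \<exists>H'. H' |\<in>| options H \<and> H' \<in> J
    then SOME H'. H' |\<in>| options H \<and> H' \<in> J else SOME H'. H' |\<in>| options H)" for H
  have good: "\<sigma> H |\<in>| options H \<and> \<sigma> H \<in> J" if "\<exists>H'. H' |\<in>| options H \<and> H' \<in> J" for H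
    using someI_ex[OF that] that by (simp add: \<sigma>_def)
  have strat: "strategy \<sigma>"
    unfolding strategy_def
  proof (intro allI impI)
    fix H assume "options H \<noteq> {||}"
    then have "\<exists>H'. H' |\<in>| options H" by auto
    from someI_ex[OF this] good show "\<sigma> H |\<in>| options H"
      by (cases "\<exists>H'. H' |\<in>| options H \<and> H' \<in> J") (auto simp: \<sigma>_def)
  qed
  have opponent_neq: "opponent p \<noteq> p" by (cases p) auto
  have inv: "r = p \<and> H \<in> I \<or> r = opponent p \<and> H \<in> J" if "reachable p \<sigma> G q H r" for H r
    using that
  proof induction
    case start
    show ?case by (fact start)
  next
    case (own_move H)
    then have "H \<in> I" "\<not> terminal H" using opponent_neq by (auto simp: options_terminal)
    with own good show ?case by blast
  next
    case (opponent_move H H')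
    then show ?case using opponent_neq opp by auto
  qed
  with final strat show ?thesis
    unfolding winning_strategy_def by blast
qed

lemma is_position_option: "is_position G \<Longrightarrow> G' |\<in>| options G \<Longrightarrow> is_position G'"
  by (auto elim: is_position.cases)

lemma options_nonempty: "is_position G \<Longrightarrow> \<not> terminal G \<Longrightarrow> options G \<noteq> {||}"
  by (auto elim: is_position.cases)

text \<open>Let the two strategies play against each other: the resulting play is reachable under
  both. Sizes decrease along it, so it ends, and its last position would have to be won by both
  players.\<close>

lemma not_both_winning:
  assumes "is_position G" "winning_strategy p \<sigma> G q" "winning_strategy (opponent p) \<tau> G q"
  shows False
proof -
  have opponent_opponent: "opponent (opponent p) = p" by (cases p) auto
  have False if "is_position H" "reachable p \<sigma> G q H r" "reachable (opponent p) \<tau> G q H r" for H r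
    using that
  proof (induction "size H" arbitrary: H r rule: less_induct)
    case less
    show False
    proof (cases "terminal H")
      case True
      with less.prems assms(2,3) have "H = won_terminal p" "H = won_terminal (opponent p)"
        unfolding winning_strategy_def by blast+
      then show False by (cases p) auto
    next
      case False
      with less.prems have ne: "options H \<noteq> {||}" by (simp add: options_nonempty)
      \<comment> \<open>The player to move follows their own strategy; for the other player's
        strategy this is just some opponent move.\<close>
      have step: "\<exists>H' r'. H' |\<in>| options H \<and> reachable p \<sigma> G q H' r' \<and>
          reachable (opponent p) \<tau> G q H' r'"
      proof (cases "r = p")
        case True
        have "\<sigma> H |\<in>| options H"
          using assms(2) ne by (auto simp: winning_strategy_def strategy_def)
        moreover have "reachable p \<sigma> G q (\<sigma> H) (opponent p)"
          using less.prems True ne by (auto intro: reachable.own_move)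
        moreover have "reachable (opponent p) \<tau> G q (\<sigma> H) (opponent p)"
          using less.prems True calculation(1)
          by (auto intro: reachable.opponent_move simp: opponent_opponent)
        ultimately show ?thesis by blast
      next
        case False
        then have r: "r = opponent p" by (cases p; cases r) auto
        have "\<tau> H |\<in>| options H"
          using assms(3) ne by (auto simp: winning_strategy_def strategy_def)
        moreover have "reachable (opponent p) \<tau> G q (\<tau> H) p"
          using less.prems r ne reachable.own_move[of "opponent p" \<tau> G q H]
          by (auto simp: opponent_opponent)
        moreover have "reachable p \<sigma> G q (\<tau> H) p"
          using less.prems r calculation(1) by (auto intro: reachable.opponent_move)
        ultimately show ?thesis by blast
      qed
      then show False
        using less.hyps less.prems(1) is_position_option size_option_less by blast
    qed
  qed
  then show False using assms(1) by (blast intro: reachable.start)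
qed

section \<open>Moves in sums of stars\<close>

lemma options_plus:
  "K |\<in>| options (G + H) \<longleftrightarrow>
     (\<exists>G'. G' |\<in>| options G \<and> K = G' + H) \<or> (\<exists>H'. H' |\<in>| options H \<and> K = G + H')"
  by (auto simp: plus_pos_def options_disj_sum)

lemma terminal_plus [simp]: "terminal (G + H) \<longleftrightarrow> terminal G \<and> terminal H"
  by (simp add: plus_pos_def)

lemma options_bigstar:
  "K |\<in>| options (bigstar m) \<longleftrightarrow> terminal K \<or> (\<exists>k. 1 \<le> k \<and> k < m \<and> K = bigstar k)"
  by (subst bigstar.simps) (auto simp: fset_of_list_elem terminal_def)

lemma not_terminal_bigstar [simp]: "\<not> terminal (bigstar m)"
  by (subst bigstar.simps) simp

text \<open>Since \<open>T\<close> has no options, every move is made in exactly one star. The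
  result \<open>K'\<close> stands in front so that it can later be merged into \<open>T\<close> if
  terminal, or become a new list entry if a star.\<close>

lemma options_sum_list_bigstar:
  assumes "terminal T"
  shows "K |\<in>| options (sum_list (map bigstar a) + T) \<longleftrightarrow>
    (\<exists>xs m ys K'. a = xs @ m # ys \<and> K' |\<in>| options (bigstar m) \<and>
       K = K' + (sum_list (map bigstar (xs @ ys)) + T))"
proof (induction a arbitrary: K)
  case Nil
  then show ?case using assms by (auto simp: options_terminal)
next
  case (Cons n a)
  have "K |\<in>| options (sum_list (map bigstar (n # a)) + T) \<longleftrightarrow>
      (\<exists>K'. K' |\<in>| options (bigstar n) \<and> K = K' + (sum_list (map bigstar a) + T)) \<or>
      (\<exists>H. H |\<in>| options (sum_list (map bigstar a) + T) \<and> K = bigstar n + H)"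
    by (simp add: add.assoc options_plus[of _ "bigstar n"])
  also have "\<dots> \<longleftrightarrow> (\<exists>xs m ys K'. n # a = xs @ m # ys \<and> K' |\<in>| options (bigstar m) \<and>
       K = K' + (sum_list (map bigstar (xs @ ys)) + T))" (is "?A \<or> ?B \<longleftrightarrow> ?C")
  proof
    assume "?A \<or> ?B"
    then show ?C
    proof
      assume ?A
      then show ?C by (metis append_Nil)
    next
      assume ?B
      then obtain xs m ys K' where "a = xs @ m # ys" "K' |\<in>| options (bigstar m)"
        "K = bigstar n + (K' + (sum_list (map bigstar (xs @ ys)) + T))"
        unfolding Cons.IH by blast
      then have "n # a = (n # xs) @ m # ys \<and> K' |\<in>| options (bigstar m) \<and>
          K = K' + (sum_list (map bigstar ((n # xs) @ ys)) + T)"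
        by (simp add: ac_simps)
      then show ?C by blast
    qed
  next
    assume ?C
    then obtain xs m ys K' where *: "n # a = xs @ m # ys" "K' |\<in>| options (bigstar m)"
      "K = K' + (sum_list (map bigstar (xs @ ys)) + T)" by blast
    show "?A \<or> ?B"
    proof (cases xs)
      case Nil
      with * show ?thesis by auto
    next
      case (Cons x xs')
      with * have a: "a = xs' @ m # ys" "x = n" by auto
      have "K = bigstar n + (K' + (sum_list (map bigstar (xs' @ ys)) + T))"
        using * Cons a by (simp add: ac_simps)
      with a *(2) show ?thesis unfolding Cons.IH by blast
    qed
  qed
  finally show ?case .
qed

section \<open>Nim-sum arithmetic\<close>

lemma foldr_xor_append_Cons:
  "foldr xor (xs @ m # ys) 0 = xor m (foldr xor (xs @ ys) (0 :: nat))"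
  by (induction xs) (simp_all add: xor.left_commute)

lemma xor_eq_0_iff_nat: "xor m n = 0 \<longleftrightarrow> m = n" for m n :: nat
  by (metis xor.assoc xor_self_eq xor.right_neutral xor.left_neutral)

text \<open>Bit \<open>d\<close> is the highest at which \<open>k\<close> and \<open>m\<close>
  differ. Dividing by \<open>2 ^ d\<close> gives an even and an odd number with equal halves, so the
  even one is smaller.\<close>

lemma less_if_top_bit:
  fixes k m :: nat
  assumes "bit m d" "\<not> bit k d" "\<And>n. n > d \<Longrightarrow> bit k n \<longleftrightarrow> bit m n"
  shows "k < m"
proof -
  have "drop_bit (Suc d) k = drop_bit (Suc d) m"
    by (rule bit_eqI) (use assms(3) in \<open>simp add: bit_drop_bit_eq\<close>)
  then have "(k div 2 ^ d) div 2 = (m div 2 ^ d) div 2"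
    by (simp add: drop_bit_eq_div div_mult2_eq[symmetric] mult.commute)
  moreover have "odd (m div 2 ^ d)" "even (k div 2 ^ d)"
    using assms(1,2) by (simp_all add: bit_iff_odd)
  ultimately have "k div 2 ^ d < m div 2 ^ d"
    by (metis even_two_times_div_two odd_two_times_div_two_succ less_add_one)
  then show ?thesis by (meson div_le_mono leD leI)
qed

lemma bit_foldr_xor:
  "bit (foldr xor a (0 :: nat)) d \<Longrightarrow> \<exists>m\<in>set a. bit m d"
  by (induction a) (auto simp: bit_xor_iff)

text \<open>Bouton's reply: some entry \<open>m\<close> contains the top bit of the nim-sum
  \<open>s\<close>. Then \<open>xor m s\<close> is the nim-sum of the other entries, and it is below
  \<open>m\<close> because the highest changed bit is cleared.\<close>

lemma nim_move:
  assumes "foldr xor a (0 :: nat) \<noteq> 0"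
  shows "\<exists>xs m ys. a = xs @ m # ys \<and> foldr xor (xs @ ys) 0 < m"
proof -
  define s where "s = foldr xor a 0"
  \<comment> \<open>A set bit forces \<open>n < 2 ^ n \<le> s\<close>; this bounds the set of bits,
    so a top bit exists.\<close>
  have "bit s n \<Longrightarrow> n < s" for n
    by (metis bit_iff_odd div_less even_zero leI less_exp order_le_less_trans)
  then have fin: "finite {n. bit s n}" by (auto intro: finite_subset[of _ "{..<s}"])
  have ne: "{n. bit s n} \<noteq> {}"
    using assms bit_eq_iff[of s 0] by (auto simp: s_def)
  define d where "d = Max {n. bit s n}"
  have d: "bit s d" using Max_in[OF fin ne] by (simp add: d_def)
  have above: "\<not> bit s n" if "n > d" for n
    using Max_ge[OF fin, of n] that by (auto simp: d_def)
  obtain m where m: "m \<in> set a" "bit m d" using bit_foldr_xor d s_def by blast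
  then obtain xs ys where a: "a = xs @ m # ys" by (meson split_list)
  have "xor m s < m"
    using m(2) d above by (intro less_if_top_bit[of m d]) (auto simp: bit_xor_iff)
  moreover have "xor m s = foldr xor (xs @ ys) 0"
    unfolding s_def a foldr_xor_append_Cons by (simp flip: xor.assoc)
  ultimately show ?thesis using a by auto
qed

section \<open>Bouton's argument for stars\<close>

text \<open>\<open>T\<close> accumulates the stars already played to a terminal. Requiring a
  nonempty list keeps these positions nonterminal. The parameter \<open>P\<close> yields both the
  zero and the nonzero class.\<close>

definition star_sums :: "(nat \<Rightarrow> bool) \<Rightarrow> pos set" where
  "star_sums P = {sum_list (map bigstar a) + T | a T.
     a \<noteq> [] \<and> (\<forall>m\<in>set a. 1 \<le> m) \<and> terminal T \<and> P (foldr xor a 0)}"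

lemma star_sumsI:
  "a \<noteq> [] \<Longrightarrow> \<forall>m\<in>set a. 1 \<le> m \<Longrightarrow> terminal T \<Longrightarrow> P (foldr xor a 0) \<Longrightarrow>
   sum_list (map bigstar a) + T \<in> star_sums P"
  unfolding star_sums_def by blast

lemma not_terminal_star_sums: "G \<in> star_sums P \<Longrightarrow> \<not> terminal G"
  by (auto simp: star_sums_def neq_Nil_conv)

text \<open>If the nim-sum is zero, the untouched stars have nim-sum \<open>m\<close>. Replacing
  \<open>m\<close> by some \<open>k < m\<close>, where a terminal acts as \<open>k = 0\<close>,
  cannot balance them.\<close>

lemma zero_star_sums_option:
  assumes "G \<in> star_sums (\<lambda>s. s = 0)" "G' |\<in>| options G"
  shows "G' \<in> star_sums (\<lambda>s. s \<noteq> 0)"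
proof -
  obtain a T where a: "\<forall>m\<in>set a. 1 \<le> m" "terminal T" "foldr xor a 0 = 0"
    and G: "G = sum_list (map bigstar a) + T"
    using assms(1) unfolding star_sums_def by blast
  obtain xs m ys K where split: "a = xs @ m # ys" and K: "K |\<in>| options (bigstar m)"
    and G': "G' = K + (sum_list (map bigstar (xs @ ys)) + T)"
    using assms(2) unfolding G options_sum_list_bigstar[OF a(2)] by blast
  have m: "foldr xor (xs @ ys) 0 = m"
    using a(3) unfolding split foldr_xor_append_Cons xor_eq_0_iff_nat by simp
  have "1 \<le> m" using a(1) split by auto
  from K consider "terminal K" | k where "1 \<le> k" "k < m" "K = bigstar k"
    by (auto simp: options_bigstar)
  then show ?thesis
  proof cases
    case 1
    \<comment> \<open>A lone star has nonzero nim-sum, so another star remains and the play is not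
      over.\<close>
    have "xs @ ys \<noteq> []" using m \<open>1 \<le> m\<close> by (cases "xs @ ys") auto
    then have "sum_list (map bigstar (xs @ ys)) + (K + T) \<in> star_sums (\<lambda>s. s \<noteq> 0)"
      using a split m \<open>1 \<le> m\<close> 1 by (intro star_sumsI) auto
    then show ?thesis unfolding G' by (simp add: ac_simps)
  next
    case 2
    have "foldr xor (k # xs @ ys) 0 \<noteq> 0"
      using 2 m xor_eq_0_iff_nat[of k m] by simp
    then have "sum_list (map bigstar (k # xs @ ys)) + T \<in> star_sums (\<lambda>s. s \<noteq> 0)"
      using a split 2 by (intro star_sumsI) auto
    then show ?thesis unfolding G' 2 by (simp add: ac_simps)
  qed
qed

lemma nonzero_star_sums_option:
  assumes "G \<in> star_sums (\<lambda>s. s \<noteq> 0)"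
  shows "\<exists>G'. G' |\<in>| options G \<and> (G' \<in> star_sums (\<lambda>s. s = 0) \<or> G' = won_terminal p)"
proof -
  obtain a T where a: "\<forall>m\<in>set a. 1 \<le> m" "terminal T" "foldr xor a 0 \<noteq> 0"
    and G: "G = sum_list (map bigstar a) + T"
    using assms unfolding star_sums_def by blast
  obtain xs m ys where split: "a = xs @ m # ys" and less: "foldr xor (xs @ ys) 0 < m"
    using nim_move[OF a(3)] by blast
  \<comment> \<open>The heap size that balances the other stars.\<close>
  define k where "k = foldr xor (xs @ ys) 0"
  have opt: "K + (sum_list (map bigstar (xs @ ys)) + T) |\<in>| options G"
    if "K |\<in>| options (bigstar m)" for K
    using that split unfolding G options_sum_list_bigstar[OF a(2)] by blast
  consider "xs @ ys = []" | "xs @ ys \<noteq> []" "k = 0" | "1 \<le> k" by linarith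
  then show ?thesis
  proof cases
    case 1
    \<comment> \<open>Only one star is left. Two terminals sum to \<open>StarL\<close> exactly when
      they agree, so Left takes \<open>K = T\<close> and Right the other terminal.\<close>
    obtain K where K: "terminal K" "K + T = won_terminal p"
      using a(2) disj_sum_terminal unfolding terminal_def plus_pos_def
      by (cases p) (metis won_terminal.simps)+
    then have "won_terminal p |\<in>| options G"
      using opt[of K] 1 by (simp add: options_bigstar)
    then show ?thesis by blast
  next
    case 2
    \<comment> \<open>The balancing heap is empty here; it is realised by a terminal, since
      \<open>bigstar 0\<close> equals \<open>bigstar 1\<close>.\<close>
    have "sum_list (map bigstar (xs @ ys)) + (StarL + T) \<in> star_sums (\<lambda>s. s = 0)"
      using 2 a split by (intro star_sumsI) (auto simp: k_def)
    moreover have "sum_list (map bigstar (xs @ ys)) + (StarL + T) |\<in>| options G"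
      using opt[of StarL] by (simp add: options_bigstar ac_simps)
    ultimately show ?thesis by blast
  next
    case 3
    have "foldr xor (k # xs @ ys) 0 = 0"
      by (simp add: k_def)
    then have "sum_list (map bigstar (k # xs @ ys)) + T \<in> star_sums (\<lambda>s. s = 0)"
      using a split 3 by (intro star_sumsI) auto
    moreover have "sum_list (map bigstar (k # xs @ ys)) + T |\<in>| options G"
      using opt[of "bigstar k"] 3 less by (auto simp: options_bigstar k_def ac_simps)
    ultimately show ?thesis by blast
  qed
qed

lemma star_sums_winning:
  assumes "q = p \<and> G \<in> star_sums (\<lambda>s. s \<noteq> 0) \<or> q = opponent p \<and> G \<in> star_sums (\<lambda>s. s = 0)"
  shows "\<exists>\<sigma>. winning_strategy p \<sigma> G q"
proof (rule winning_strategyI)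
  \<comment> \<open>The last move leads out of the star sums, so the won terminal is adjoined; it is
    the only terminal position in either set.\<close>
  let ?I = "insert (won_terminal p) (star_sums (\<lambda>s. s \<noteq> 0))"
  let ?J = "insert (won_terminal p) (star_sums (\<lambda>s. s = 0))"
  have won: "terminal (won_terminal p)" by (cases p) auto
  show "\<exists>H'. H' |\<in>| options H \<and> H' \<in> ?J" if "H \<in> ?I" "\<not> terminal H" for H
    using that won nonzero_star_sums_option[of H p] by auto
  show "H' \<in> ?I" if "H \<in> ?J" "H' |\<in>| options H" for H H'
    using that won zero_star_sums_option by (auto simp: options_terminal)
  show "H = won_terminal p" if "H \<in> ?I \<union> ?J" "terminal H" for H
    using that not_terminal_star_sums by blast
  show "q = p \<and> G \<in> ?I \<or> q = opponent p \<and> G \<in> ?J"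
    using assms by blast
qed

theorem theorem3p8:
  fixes a :: "nat list"
  assumes "length a \<ge> 1" and "\<forall>m \<in> set a. m \<ge> 1"
  shows "sum_list (map bigstar a) \<in> outcome_P \<longleftrightarrow> foldr xor a 0 = 0"
proof -
  let ?G = "sum_list (map bigstar a)"
  have mem: "?G \<in> star_sums P" if "P (foldr xor a 0)" for P
  proof -
    have "?G + 0 \<in> star_sums P"
      using assms that by (intro star_sumsI) (auto simp: zero_pos_def)
    then show ?thesis by simp
  qed
  have pos: "is_position ?G" by (rule is_position_sum_list_bigstar)
  show ?thesis
  proof
    assume P: "?G \<in> outcome_P"
    show "foldr xor a 0 = 0"
    proof (rule ccontr)
      assume "foldr xor a 0 \<noteq> 0"
      then have "?G \<in> star_sums (\<lambda>s. s \<noteq> 0)" by (rule mem)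
      \<comment> \<open>It suffices to let Left start: as first player Left wins, while membership
        in \<open>outcome_P\<close> would give Right a win in the same game.\<close>
      then obtain \<sigma> where "winning_strategy Left \<sigma> ?G Left"
        using star_sums_winning[of Left Left] by blast
      moreover obtain \<tau> where "winning_strategy (opponent Left) \<tau> ?G Left"
        using P unfolding outcome_P_def by blast
      ultimately show False using not_both_winning pos by blast
    qed
  next
    assume "foldr xor a 0 = 0"
    then have "?G \<in> star_sums (\<lambda>s. s = 0)" by (rule mem)
    \<comment> \<open>This identifies the first mover \<open>q\<close> as the opponent of the second
      player, to whom \<open>star_sums_winning\<close> is applied.\<close>
    moreover have "q = opponent (opponent q)" for q by (cases q) auto
    ultimately show "?G \<in> outcome_P"
      using star_sums_winning pos unfolding outcome_P_def by blast
  qed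
qed

end
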